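(* Let the type space be $\mathcal V_b=[0,1]$. The mechanism design problem $$\max_{I,t}\ \mathbb E_{v_b\sim F}\left[t(v_b)-c(I(v_b);\tau)\right]$$ over $I:[0,1]\to[-1,1]$ and $t:[0,1]\to\mathbb R_{\ge0}$, subject to, for all $v_b,b\in[0,1]$, $$\delta(I(v_b),v_b)-t(v_b)\ge0,\qquad \delta(I(v_b),v_b)-t(v_b)\ge\delta(I(b),v_b)-t(b),$$ reduces to the problem $$\max_{I}\ \mathbb E_{v_b\sim F}[J(I,v_b)]\quad\text{s.t.}\quad\int_0^1I(v_b)\,dv_b=0,\quad I:[0,1]\to[-1,1]\text{ non-decreasing},$$ where $$J(I,v_b)=I(v_b)\left(v_b+\frac{F(v_b)}{p(v_b)}+\tau v_s(1-2v_s)+\mathbf 1_{\{I(v_b)\ge0\}}\left(\tau(1-2v_s)^2-1\right)\right).$$ That is, an allocation $I$ is the allocation part of an optimal solution $(I,t)$ of the first problem if and only if $I$ is an optimal solution of the second problem.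
   Context: $F$ is the distribution function of the buyer's type $v_b$ on $[0,1]$, with (positive) density $p$ having support $[0,1]$. $v_s\in[0,1]$ is the seller's belief that the binary state $X$ equals $0$, and $\tau\ge0$ is a competition parameter. The buyer's gain from a communication rule of informativeness $I(b)\in[-1,1]$ is $$\delta(I(b),v_b)=1-\max\{v_b,1-v_b\}-I(b)\left(\mathbf 1_{\{I(b)\ge0\}}-v_b\right).$$ The rule of informativeness $I$ has two messages $m_0,m_1$ with $P(m_1\mid X=1)=1-\max\{I,0\}$ and $P(m_0\mid X=0)=I+1-\max\{I,0\}$. Message $m_k$ makes the buyer take action $k$. The seller's cost is $c(I;\tau)=\tau v_sP(m_0;v_s)+\tau(1-v_s)P(m_1;v_s)$, where $P(m;v_s)=v_sP(m\mid X=0)+(1-v_s)P(m\mid X=1)$. Explicitly, $$c(I;\tau)=\tau v_s+\tau(1-2v_s)(1-v_s)-\tau(1-2v_s)\,I\left(v_s+(1-2v_s)\mathbf 1_{\{I\ge0\}}\right).$$ *)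

theory Defs
  imports "HOL-Probability.Probability"
begin

text \<open>
  The type space is the interval \<open>{0..1}\<close>. Allocations and transfers are total functions
  \<open>real \<Rightarrow> real\<close> of which only the values on \<open>{0..1}\<close> are constrained and used.
  A belief (\<open>v\<close> of the buyer, \<open>v_s\<close> of the seller) is the probability of the state being 0.
\<close>

definition buyer_gain :: "real \<Rightarrow> real \<Rightarrow> real" where
  "buyer_gain x v = 1 - max v (1 - v) - x * (of_bool (x \<ge> 0) - v)"

datatype state = X0 | X1
datatype message = M0 | M1

text \<open>Conditional probability of a message given the state, under the rule of informativeness \<open>x\<close>.\<close>

fun message_prob_given :: "real \<Rightarrow> message \<Rightarrow> state \<Rightarrow> real" where
  "message_prob_given x M0 X0 = x + 1 - max x 0"
| "message_prob_given x M1 X0 = 1 - (x + 1 - max x 0)"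
| "message_prob_given x M1 X1 = 1 - max x 0"
| "message_prob_given x M0 X1 = 1 - (1 - max x 0)"

definition message_prob :: "real \<Rightarrow> real \<Rightarrow> message \<Rightarrow> real" where
  "message_prob v x m = v * message_prob_given x m X0 + (1 - v) * message_prob_given x m X1"

definition seller_cost :: "real \<Rightarrow> real \<Rightarrow> real \<Rightarrow> real" where
  "seller_cost \<tau> v_s x =
     \<tau> * v_s * message_prob v_s x M0 + \<tau> * (1 - v_s) * message_prob v_s x M1"

lemma seller_cost_explicit:
  "seller_cost \<tau> v_s x =
     \<tau> * v_s + \<tau> * (1 - 2 * v_s) * (1 - v_s)
       - \<tau> * (1 - 2 * v_s) * x * (v_s + (1 - 2 * v_s) * of_bool (x \<ge> 0))"
  by (cases "x \<ge> 0")
     (simp_all add: seller_cost_def message_prob_def max_def algebra_simps)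

text \<open>
  Expectation over the buyer's type with law \<open>D\<close>. The integral is restricted to the type space
  because the integrands need not be measurable outside it. For the objectives below,
  feasibility forces the allocation to be monotone on \<open>{0..1}\<close>, which makes the integrands
  integrable, so that the default value 0 of the Bochner integral plays no role.
\<close>

definition expect_type :: "real measure \<Rightarrow> (real \<Rightarrow> real) \<Rightarrow> real" where
  "expect_type D f = (LINT v:{0..1}|D. f v)"

definition feasible_mechanism :: "(real \<Rightarrow> real) \<times> (real \<Rightarrow> real) \<Rightarrow> bool" where
  "feasible_mechanism = (\<lambda>(I, t).
     (\<forall>v\<in>{0..1}. I v \<in> {-1..1}) \<and>
     (\<forall>v\<in>{0..1}. t v \<ge> 0) \<and>
     (\<forall>v\<in>{0..1}. buyer_gain (I v) v - t v \<ge> 0) \<and>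
     (\<forall>v\<in>{0..1}. \<forall>b\<in>{0..1}. buyer_gain (I v) v - t v \<ge> buyer_gain (I b) v - t b))"

definition seller_profit ::
    "real measure \<Rightarrow> real \<Rightarrow> real \<Rightarrow> (real \<Rightarrow> real) \<times> (real \<Rightarrow> real) \<Rightarrow> real" where
  "seller_profit D \<tau> v_s = (\<lambda>(I, t). expect_type D (\<lambda>v. t v - seller_cost \<tau> v_s (I v)))"

definition optimal_mechanism ::
    "real measure \<Rightarrow> real \<Rightarrow> real \<Rightarrow> (real \<Rightarrow> real) \<Rightarrow> (real \<Rightarrow> real) \<Rightarrow> bool" where
  "optimal_mechanism D \<tau> v_s I t \<longleftrightarrow>
     is_arg_max (seller_profit D \<tau> v_s) feasible_mechanism (I, t)"

definition feasible_allocation :: "(real \<Rightarrow> real) \<Rightarrow> bool" where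
  "feasible_allocation I \<longleftrightarrow>
     (\<forall>v\<in>{0..1}. I v \<in> {-1..1}) \<and> mono_on {0..1} I \<and> (LBINT v:{0..1}. I v) = 0"

definition virtual_surplus ::
    "(real \<Rightarrow> real) \<Rightarrow> (real \<Rightarrow> real) \<Rightarrow> real \<Rightarrow> real \<Rightarrow> (real \<Rightarrow> real) \<Rightarrow> real \<Rightarrow> real" where
  "virtual_surplus F p \<tau> v_s I v =
     I v * (v + F v / p v + \<tau> * v_s * (1 - 2 * v_s)
              + of_bool (I v \<ge> 0) * (\<tau> * (1 - 2 * v_s)\<^sup>2 - 1))"

definition optimal_allocation ::
    "real measure \<Rightarrow> (real \<Rightarrow> real) \<Rightarrow> real \<Rightarrow> real \<Rightarrow> (real \<Rightarrow> real) \<Rightarrow> bool" where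
  "optimal_allocation D p \<tau> v_s I \<longleftrightarrow>
     is_arg_max (\<lambda>I. expect_type D (virtual_surplus (cdf D) p \<tau> v_s I)) feasible_allocation I"

end

theory Submission imports Defs begin

text \<open>
  Write the buyer's payoff as \<open>min v (1 - v) + w v\<close>. Incentive compatibility says exactly
  that \<open>I v\<close> is a subgradient of \<open>w\<close> at \<open>v\<close>, so \<open>I\<close> is monotone and \<open>w\<close> is its integral.
  An extreme type gains nothing without paying, so participation and nonnegative transfers give
  \<open>w 0 = w 1 = 0\<close>; this yields the integral constraint and determines the
  transfers from the allocation. Conversely, monotonicity and the integral constraint give back
  all the constraints of the mechanism. Substituting the transfers into the seller's profit and
  exchanging the order of integration turns it into the virtual surplus, up to a constant.
\<close>

definition rent :: "(real \<Rightarrow> real) \<Rightarrow> real \<Rightarrow> real" where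
  "rent I v = (LBINT x:{0..<v}. I x)"

text \<open>The one payment that leaves type \<open>v\<close> the payoff
  \<open>min v (1 - v) + rent I v\<close>.\<close>

definition rent_transfer :: "(real \<Rightarrow> real) \<Rightarrow> real \<Rightarrow> real" where
  "rent_transfer I v = I v * v - max (I v) 0 - rent I v"

lemma buyer_gain_eq: "buyer_gain x v = min v (1 - v) + x * v - max x 0"
  by (auto simp: buyer_gain_def algebra_simps)

section \<open>Integrability of monotone functions on a compact interval\<close>

lemma set_borel_measurable_mono_on:
  fixes f :: "real \<Rightarrow> real"
  assumes "mono_on A f" "A \<in> sets borel"
  shows "set_borel_measurable borel A f"
  using borel_measurable_mono_on_fnc[OF assms(1)] assms(2)
  unfolding set_borel_measurable_def by (subst (asm) borel_measurable_restrict_space_iff) auto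

lemma set_integrable_bounded_Icc:
  fixes f :: "real \<Rightarrow> real"
  assumes meas: "set_borel_measurable borel {a..b} f"
    and bound: "\<And>x. x \<in> {a..b} \<Longrightarrow> \<bar>f x\<bar> \<le> B"
  shows "set_integrable lborel {a..b} f"
proof (rule set_integrable_bound)
  show "set_integrable lborel {a..b} (\<lambda>_. B)"
    by (simp add: set_integrable_def emeasure_lborel_Icc_eq)
  show "set_borel_measurable lborel {a..b} f"
    using meas by (simp add: set_borel_measurable_def)
  show "AE x in lborel. x \<in> {a..b} \<longrightarrow> norm (f x) \<le> norm B"
    using bound by (intro AE_I2) force
qed

lemma set_integrable_mono_on:
  fixes f :: "real \<Rightarrow> real"
  assumes "mono_on {a..b} f"
  shows "set_integrable lborel {a..b} f"
proof (rule set_integrable_bounded_Icc[OF set_borel_measurable_mono_on[OF assms]])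
  show "\<bar>f x\<bar> \<le> \<bar>f a\<bar> + \<bar>f b\<bar>" if "x \<in> {a..b}" for x
    using mono_onD[OF assms, of a x] mono_onD[OF assms, of x b] that by auto
qed auto

section \<open>Increments and subgradients of the rent\<close>

lemma rent_0 [simp]: "rent I 0 = 0"
  by (simp add: rent_def set_lebesgue_integral_def)

lemma rent_1: "rent I 1 = (LBINT v:{0..1}. I v)"
  unfolding rent_def set_lebesgue_integral_def
  by (intro integral_discrete_difference[where X = "{1}"]) (auto simp: indicator_def)

lemma rent_increment:
  assumes "mono_on {0..1} I" "0 \<le> a" "a \<le> b" "b \<le> 1"
  shows "I a * (b - a) \<le> rent I b - rent I a" "rent I b - rent I a \<le> I b * (b - a)"
proof -
  note int = set_integrable_mono_on[OF assms(1)]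
  have ab: "set_integrable lborel {a..<b} I"
    using assms by (intro set_integrable_subset[OF int]) auto
  have "{0..<b} = {0..<a} \<union> {a..<b}"
    using assms by auto
  then have *: "rent I b - rent I a = (LBINT x:{a..<b}. I x)"
    unfolding rent_def using assms ab
    by (simp, subst set_integral_Un) (auto intro: set_integrable_subset[OF int])
  have const: "set_integrable lborel {a..<b} (\<lambda>_. c)" "(LBINT x:{a..<b}. c) = c * (b - a)" for c :: real
    using assms by (auto simp: set_integrable_def set_lebesgue_integral_def)
  have "(LBINT x:{a..<b}. I a) \<le> (LBINT x:{a..<b}. I x)" "(LBINT x:{a..<b}. I x) \<le> (LBINT x:{a..<b}. I b)"
    using assms by (auto intro!: set_integral_mono const ab mono_onD[OF assms(1)])
  then show "I a * (b - a) \<le> rent I b - rent I a" "rent I b - rent I a \<le> I b * (b - a)"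
    by (simp_all add: * const)
qed

text \<open>This is incentive compatibility for type \<open>v\<close> reporting \<open>b\<close>. An
  upward step from \<open>b\<close> uses the lower increment bound, a downward step the upper one;
  in both the slope is that at \<open>b\<close>.\<close>

lemma rent_subgradient:
  assumes "mono_on {0..1} I" "v \<in> {0..1}" "b \<in> {0..1}"
  shows "rent I b + I b * (v - b) \<le> rent I v"
  using rent_increment[OF assms(1), of b v] rent_increment[OF assms(1), of v b] assms(2,3)
  by (cases "b \<le> v") (auto simp: algebra_simps)

text \<open>Summing the bound over \<open>n\<close> equal steps gives \<open>\<bar>d b - d a\<bar> \<le> (f b - f a) * (b - a) / n\<close>.\<close>

lemma eq_if_increments_le:
  fixes d f :: "real \<Rightarrow> real"
  assumes le: "\<And>x y. a \<le> x \<Longrightarrow> x \<le> y \<Longrightarrow> y \<le> b \<Longrightarrow> \<bar>d y - d x\<bar> \<le> (f y - f x) * (y - x)"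
    and "a \<le> b"
  shows "d b = d a"
proof -
  have bound: "real n * \<bar>d b - d a\<bar> \<le> (f b - f a) * (b - a)" if "n > 0" for n :: nat
  proof -
    define h where "h = (b - a) / n"
    define x where "x i = a + real i * h" for i
    have h: "h \<ge> 0" "real n * h = b - a"
      using assms(2) that by (auto simp: h_def)
    have x: "x 0 = a" "x n = b"
      using h by (auto simp: x_def)
    have "d b - d a = (\<Sum>i<n. d (x (Suc i)) - d (x i))"
      using x sum_lessThan_telescope[of "\<lambda>i. d (x i)" n] by simp
    also have "\<bar>\<dots>\<bar> \<le> (\<Sum>i<n. \<bar>d (x (Suc i)) - d (x i)\<bar>)"
      by (rule sum_abs)
    also have "\<dots> \<le> (\<Sum>i<n. (f (x (Suc i)) - f (x i)) * h)"
    proof (rule sum_mono)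
      fix i assume "i \<in> {..<n}"
      then have "real (Suc i) * h \<le> real n * h"
        using h by (intro mult_right_mono) auto
      then have "x (Suc i) \<le> b"
        using h by (simp add: x_def)
      moreover have "a \<le> x i" "x (Suc i) = x i + h"
        using h by (auto simp: x_def algebra_simps)
      ultimately show "\<bar>d (x (Suc i)) - d (x i)\<bar> \<le> (f (x (Suc i)) - f (x i)) * h"
        using le[of "x i" "x (Suc i)"] h by simp
    qed
    also have "\<dots> = (f b - f a) * h"
      using x sum_lessThan_telescope[of "\<lambda>i. f (x i)" n] by (simp flip: sum_distrib_right)
    finally have "real n * \<bar>d b - d a\<bar> \<le> real n * ((f b - f a) * h)"
      by (intro mult_left_mono) auto
    also have "\<dots> = (f b - f a) * (b - a)"
      by (simp add: mult.left_commute h(2))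
    finally show ?thesis .
  qed
  show ?thesis
  proof (rule ccontr)
    assume "d b \<noteq> d a"
    then obtain n where "(f b - f a) * (b - a) < real n * \<bar>d b - d a\<bar>"
      using reals_Archimedean3[of "\<bar>d b - d a\<bar>"] by auto
    \<comment> \<open>The chosen \<open>n\<close> might be 0, where \<open>bound\<close> says
      nothing; its defining inequality would then make this product negative.\<close>
    moreover have "0 \<le> (f b - f a) * (b - a)"
      using le[of a b] assms(2) by (smt (verit))
    ultimately show False
      using bound[of n] by (cases "n = 0") auto
  qed
qed

section \<open>Equivalence of the two constraint sets\<close>

lemma feasible_mechanism_imp:
  assumes "feasible_mechanism (I, t)"
  shows "feasible_allocation I" "\<And>v. v \<in> {0..1} \<Longrightarrow> t v = rent_transfer I v"
proof -
  \<comment> \<open>The summand \<open>min v (1 - v)\<close> of the payoff depends on the true type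
    alone, so it cancels from the incentive constraints and is left out.\<close>
  define w where "w v = I v * v - max (I v) 0 - t v" for v
  from assms have range: "\<And>v. v \<in> {0..1} \<Longrightarrow> I v \<in> {-1..1}"
    and t: "\<And>v. v \<in> {0..1} \<Longrightarrow> t v \<ge> 0"
    and ir: "\<And>v. v \<in> {0..1} \<Longrightarrow> w v + min v (1 - v) \<ge> 0"
    and ic: "\<And>v b. v \<in> {0..1} \<Longrightarrow> b \<in> {0..1} \<Longrightarrow> w b + I b * (v - b) \<le> w v"
    by (auto simp: feasible_mechanism_def buyer_gain_eq w_def algebra_simps)
  have mono: "mono_on {0..1} I"
  proof (rule mono_onI)
    fix a b :: real assume ab: "a \<in> {0..1}" "b \<in> {0..1}" "a \<le> b"
    \<comment> \<open>Adding the constraints of \<open>a\<close> and \<open>b\<close> against each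
      other eliminates \<open>w a\<close> and \<open>w b\<close>.\<close>
    then have "I a * (b - a) \<le> I b * (b - a)"
      using ic[of a b] ic[of b a] by (simp add: algebra_simps)
    with ab show "I a \<le> I b"
      by (cases "a = b") auto
  qed
  have w0: "w 0 = 0" and w1: "w 1 = 0"
    using ir[of 0] ir[of 1] t[of 0] t[of 1] by (auto simp: w_def)
  have w: "w v = rent I v" if "v \<in> {0..1}" for v
  proof -
    have "rent I v - w v = rent I 0 - w 0"
    \<comment> \<open>On \<open>{x..y}\<close> the increments of \<open>rent I\<close> and of
      \<open>w\<close> both lie between \<open>I x * (y - x)\<close> and
      \<open>I y * (y - x)\<close>, which bounds their difference without differentiating
      \<open>w\<close>.\<close>
    proof (rule eq_if_increments_le[where d = "\<lambda>v. rent I v - w v" and f = I and a = 0 and b = v])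
      fix x y assume "0 \<le> x" "x \<le> y" "y \<le> v"
      then show "\<bar>(rent I y - w y) - (rent I x - w x)\<bar> \<le> (I y - I x) * (y - x)"
        using rent_increment[OF mono, of x y] ic[of x y] ic[of y x] that
        by (auto simp: abs_le_iff algebra_simps)
    qed (use that in auto)
    then show ?thesis
      using w0 by simp
  qed
  show "feasible_allocation I"
    using range mono w[of 1] w1 by (simp add: feasible_allocation_def rent_1)
  show "t v = rent_transfer I v" if "v \<in> {0..1}" for v
    using w[OF that] by (simp add: w_def rent_transfer_def)
qed

lemma feasible_mechanism_rent_transfer:
  assumes "feasible_allocation I"
  shows "feasible_mechanism (I, rent_transfer I)"
proof -
  from assms have range: "\<And>v. v \<in> {0..1} \<Longrightarrow> -1 \<le> I v \<and> I v \<le> 1"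
    and mono: "mono_on {0..1} I" and r1: "rent I 1 = 0"
    by (auto simp: feasible_allocation_def rent_1)
  \<comment> \<open>The supporting line at \<open>v\<close>, evaluated at 0 and at 1 where the rent
    vanishes, bounds \<open>rent I v\<close> by \<open>I v * v\<close> and by
    \<open>I v * v - I v\<close>.\<close>
  have "rent_transfer I v \<ge> 0" if "v \<in> {0..1}" for v
    using rent_subgradient[OF mono, of 0 v] rent_subgradient[OF mono, of 1 v] that r1
    by (auto simp: rent_transfer_def max_def algebra_simps)
  \<comment> \<open>The supporting lines at 0 and 1 have slopes in \<open>{-1..1}\<close>, so the
    rent is at least \<open>-v\<close> and at least \<open>-(1 - v)\<close>.\<close>
  moreover have "rent I v + min v (1 - v) \<ge> 0" if v: "v \<in> {0..1}" for v
  proof -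
    have "I 0 * v \<le> rent I v" "I 1 * (v - 1) \<le> rent I v"
      using rent_subgradient[OF mono, of v 0] rent_subgradient[OF mono, of v 1] v r1 by auto
    moreover have "-1 * v \<le> I 0 * v" "(1 - v) * I 1 \<le> (1 - v) * 1"
      using range[of 0] range[of 1] v by (intro mult_right_mono mult_left_mono; simp)+
    ultimately show ?thesis
      by (auto simp: min_def algebra_simps)
  qed
  ultimately show ?thesis
    using range rent_subgradient[OF mono]
    by (auto simp: feasible_mechanism_def buyer_gain_eq rent_transfer_def algebra_simps)
qed

text \<open>By Fubini, \<open>I x\<close> enters the rent of every type above \<open>x\<close>, so
  its weight in the expected rent is the probability of those types.\<close>

lemma (in real_distribution)
  assumes [measurable]: "I \<in> borel_measurable borel"
    and bound: "\<And>x. \<bar>I x\<bar> \<le> 1"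
    and supp: "AE v in M. v \<in> {0..1}"
  shows set_integrable_rent: "set_integrable M {0..1} (rent I)"
    and set_integral_rent:
      "(LINT v:{0..1}|M. rent I v) = (LBINT x:{0..1}. I x * (1 - cdf M x))"
proof -
  interpret pair_sigma_finite M lborel ..
  \<comment> \<open>The strict \<open>x < v\<close> matches the domain of \<open>rent\<close>; it
    also makes the inner event the exact complement of \<open>{..x}\<close>, whose probability is
    the cdf.\<close>
  define f where "f = (\<lambda>(v, x). indicator {0..1} v * (indicator {0..1} x * of_bool (x < v) * I x))"
  have f_measurable [measurable]: "f \<in> borel_measurable (M \<Otimes>\<^sub>M lborel)"
    unfolding f_def by measurable
  have int: "integrable (M \<Otimes>\<^sub>M lborel) f"
  proof (rule Bochner_Integration.integrable_bound)
    have "emeasure (M \<Otimes>\<^sub>M lborel) (UNIV \<times> {0..1::real}) = emeasure M UNIV * 1"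
      by (subst lborel.emeasure_pair_measure_Times) (auto simp: emeasure_lborel_Icc_eq)
    then show "integrable (M \<Otimes>\<^sub>M lborel) (indicator (UNIV \<times> {0..1::real}) :: _ \<Rightarrow> real)"
      by (intro integrable_real_indicator pair_measureI) (simp_all add: emeasure_eq_measure)
    show "AE z in M \<Otimes>\<^sub>M lborel. norm (f z) \<le> norm (indicator (UNIV \<times> {0..1}) z :: real)"
      using bound by (intro AE_I2) (auto simp: f_def indicator_def)
  qed fact
  have rent: "(LINT x|lborel. f (v, x)) = indicator {0..1} v *\<^sub>R rent I v" for v
    unfolding rent_def set_lebesgue_integral_def
    by (auto simp: f_def indicator_def intro!: Bochner_Integration.integral_cong)
  show "set_integrable M {0..1} (rent I)"
    using integrable_fst'[OF int] by (simp add: rent set_integrable_def)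
  have "(LINT v|M. f (v, x)) = indicator {0..1} x *\<^sub>R (I x * (1 - cdf M x))" for x
  proof -
    have "(LINT v|M. f (v, x)) = (LINT v|M. indicator {0..1} x * I x * indicator ({0..1} \<inter> {x<..}) v)"
      by (intro Bochner_Integration.integral_cong) (auto simp: f_def indicator_def)
    also have "\<dots> = indicator {0..1} x * I x * prob ({0..1} \<inter> {x<..})"
      by simp
    also have "prob ({0..1} \<inter> {x<..}) = prob {x<..}"
      using supp by (intro finite_measure_eq_AE) auto
    also have "{x<..} = space M - {..x}"
      by auto
    also have "prob \<dots> = 1 - cdf M x"
      by (subst prob_compl) (auto simp: cdf_def)
    finally show ?thesis
      by simp
  qed
  then show "(LINT v:{0..1}|M. rent I v) = (LBINT x:{0..1}. I x * (1 - cdf M x))"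
    using Fubini_integral[of "\<lambda>v x. f (v, x)"] int rent
    by (simp add: set_lebesgue_integral_def case_prod_unfold)
qed


section \<open>Expected profit as expected virtual surplus\<close>

lemma seller_cost_eq:
  "seller_cost \<tau> v_s x = \<tau> * v_s + \<tau> * (1 - 2 * v_s) * (1 - v_s)
     - \<tau> * (1 - 2 * v_s) * (v_s * x + (1 - 2 * v_s) * max x 0)"
  by (simp add: seller_cost_explicit max_def algebra_simps)

text \<open>Absorbing the indicator into \<open>max (I v) 0\<close> splits the surplus into terms
  whose integrability can be checked one by one.\<close>

lemma virtual_surplus_eq:
  "virtual_surplus F p \<tau> v_s I v = I v * v + I v * (F v / p v) + I v * (\<tau> * v_s * (1 - 2 * v_s))
     + max (I v) 0 * (\<tau> * (1 - 2 * v_s)\<^sup>2 - 1)"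
  by (auto simp: virtual_surplus_def max_def distrib_left)

context
  fixes D :: "real measure" and p :: "real \<Rightarrow> real"
  assumes dist: "real_distribution D"
    and p_measurable [measurable]: "p \<in> borel_measurable borel"
    and D_eq: "D = density lborel (\<lambda>v. ennreal (p v))"
    and p_pos: "\<And>v. v \<in> {0..1} \<Longrightarrow> p v > 0"
    and p_zero: "\<And>v. v \<notin> {0..1} \<Longrightarrow> p v = 0"
begin

interpretation real_distribution D
  by (fact dist)

lemma p_nonneg: "p v \<ge> 0"
  using p_pos[of v] p_zero[of v] by (cases "v \<in> {0..1}") auto

lemma AE_type: "AE v in D. v \<in> {0..1}"
proof -
  have "AE v in lborel. 0 < ennreal (p v) \<longrightarrow> v \<in> {0..1}"
    using p_zero by (intro AE_I2) force
  then show ?thesis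
    unfolding D_eq by (subst AE_density) auto
qed

lemma
  fixes f :: "real \<Rightarrow> real"
  assumes "f \<in> borel_measurable borel"
  shows integrable_type_iff: "integrable D f \<longleftrightarrow> integrable lborel (\<lambda>v. p v *\<^sub>R f v)"
    and integral_type_eq: "integral\<^sup>L D f = (LBINT v. p v *\<^sub>R f v)"
  unfolding D_eq using assms p_nonneg by (simp_all add: integrable_density integral_density)

lemma cdf_measurable: "cdf D \<in> borel_measurable borel"
  by (intro borel_measurable_mono monoI cdf_nondecreasing)

text \<open>The quotient \<open>cdf D v / p v\<close> may be unbounded, but integrating against the
  density cancels \<open>p v\<close> and leaves a bounded Lebesgue integrand.\<close>

lemma
  assumes [measurable]: "I \<in> borel_measurable borel" and bound: "\<And>x. \<bar>I x\<bar> \<le> 1"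
  shows set_integrable_hazard: "set_integrable D {0..1} (\<lambda>v. I v * (cdf D v / p v))"
    and set_integral_hazard:
      "(LINT v:{0..1}|D. I v * (cdf D v / p v)) = (LBINT v:{0..1}. I v * cdf D v)"
    and set_integrable_allocation_cdf: "set_integrable lborel {0..1} (\<lambda>v. I v * cdf D v)"
proof -
  note cdf_measurable [measurable]
  have eq: "p v *\<^sub>R (indicator {0..1} v *\<^sub>R (I v * (cdf D v / p v))) = indicator {0..1} v *\<^sub>R (I v * cdf D v)"
    for v
    using p_pos[of v] by (auto simp: indicator_def)
  have meas: "(\<lambda>v. indicator {0..1} v *\<^sub>R (I v * (cdf D v / p v))) \<in> borel_measurable borel"
    by measurable
  have "\<bar>I v * cdf D v\<bar> \<le> 1" for v
    using bound[of v] cdf_nonneg[of v] cdf_bounded_prob[of v] by (auto simp: abs_mult intro: mult_le_one)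
  then have "set_integrable lborel {0..1} (\<lambda>v. I v * cdf D v)"
    by (intro set_integrable_bounded_Icc) (simp_all add: set_borel_measurable_def)
  then show "set_integrable lborel {0..1} (\<lambda>v. I v * cdf D v)"
    and "set_integrable D {0..1} (\<lambda>v. I v * (cdf D v / p v))"
    unfolding set_integrable_def integrable_type_iff[OF meas] eq by assumption+
  show "(LINT v:{0..1}|D. I v * (cdf D v / p v)) = (LBINT v:{0..1}. I v * cdf D v)"
    unfolding set_lebesgue_integral_def integral_type_eq[OF meas] eq ..
qed

lemma expect_type_profit_measurable:
  assumes I [measurable]: "I \<in> borel_measurable borel"
    and bound: "\<And>x. \<bar>I x\<bar> \<le> 1"
    and zero: "(LBINT v:{0..1}. I v) = 0"
  shows "expect_type D (\<lambda>v. rent_transfer I v - seller_cost \<tau> v_s (I v)) =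
    expect_type D (virtual_surplus (cdf D) p \<tau> v_s I) - (\<tau> * v_s + \<tau> * (1 - 2 * v_s) * (1 - v_s))"
proof -
  define k where "k = \<tau> * v_s + \<tau> * (1 - 2 * v_s) * (1 - v_s)"
  let ?J = "virtual_surplus (cdf D) p \<tau> v_s I" and ?H = "\<lambda>v. I v * (cdf D v / p v)"
  note H = set_integrable_hazard[OF I bound]
  note R = set_integrable_rent[OF I bound AE_type]
  have bounded: "set_integrable D {0..1} f"
    if [measurable]: "f \<in> borel_measurable borel" and "\<And>v. v \<in> {0..1} \<Longrightarrow> \<bar>f v\<bar> \<le> B"
    for f :: "real \<Rightarrow> real" and B
    using that(2) unfolding set_integrable_def
    by (intro integrable_const_bound[where B = "\<bar>B\<bar>"]) (force simp: indicator_def)+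
  have Iv: "set_integrable D {0..1} (\<lambda>v. I v * v)"
    using bound by (intro bounded[of _ 1]) (auto simp: abs_mult intro: mult_le_one)
  have Im: "set_integrable D {0..1} I" "set_integrable D {0..1} (\<lambda>v. max (I v) 0)"
    using bound abs_le_D1[OF bound] by (auto intro!: bounded[of _ 1] simp: max_def)
  have J: "set_integrable D {0..1} ?J"
    unfolding virtual_surplus_eq[abs_def] by (intro set_integral_add set_integrable_mult_left impI Iv H Im)
  have const: "set_integrable D {0..1} (\<lambda>_. k)"
    by (rule bounded[of _ "\<bar>k\<bar>"]) auto
  have "prob {0..1} = 1"
    using AE_type by (intro prob_eq_1[THEN iffD2]) auto
  then have const_eq: "(LINT v:{0..1}|D. k) = k"
    by (simp add: set_lebesgue_integral_def)
  \<comment> \<open>The coefficient of \<open>max (I v) 0\<close> matches: -1 comes from the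
    transfer and \<open>\<tau> * (1 - 2 * v_s)\<^sup>2\<close> from the cost.\<close>
  have "rent_transfer I v - seller_cost \<tau> v_s (I v) = ?J v - (?H v + rent I v + k)" for v
    unfolding virtual_surplus_eq rent_transfer_def seller_cost_eq k_def
    by (simp add: algebra_simps power2_eq_square)
  then have "expect_type D (\<lambda>v. rent_transfer I v - seller_cost \<tau> v_s (I v)) =
      expect_type D ?J - ((LINT v:{0..1}|D. ?H v) + (LINT v:{0..1}|D. rent I v) + k)"
    using J H R const const_eq by (simp add: expect_type_def)
  \<comment> \<open>The Lebesgue weights \<open>cdf D v\<close> and \<open>1 - cdf D v\<close> add
    up to 1, so the sum is the integral of \<open>I\<close>, which is zero.\<close>
  moreover have "(LINT v:{0..1}|D. ?H v) + (LINT v:{0..1}|D. rent I v) = 0"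
  proof -
    have "set_integrable lborel {0..1} I"
      using bound by (intro set_integrable_bounded_Icc) (simp_all add: set_borel_measurable_def)
    then show ?thesis
      unfolding set_integral_hazard[OF I bound]
      using set_integrable_allocation_cdf[OF I bound] zero
      by (simp add: set_integral_rent[OF I bound AE_type] right_diff_distrib)
  qed
  ultimately show ?thesis
    by (simp add: k_def)
qed

lemma expect_type_profit:
  assumes "feasible_allocation I"
  shows "expect_type D (\<lambda>v. rent_transfer I v - seller_cost \<tau> v_s (I v)) =
    expect_type D (virtual_surplus (cdf D) p \<tau> v_s I) - (\<tau> * v_s + \<tau> * (1 - 2 * v_s) * (1 - v_s))"
proof -
  from assms have mono: "mono_on {0..1} I" and range: "\<And>v. v \<in> {0..1} \<Longrightarrow> \<bar>I v\<bar> \<le> 1"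
    and zero: "(LBINT v:{0..1}. I v) = 0"
    by (auto simp: feasible_allocation_def abs_le_iff)
  \<comment> \<open>Outside \<open>{0..1}\<close> the allocation is arbitrary, possibly not
    measurable. Its extension by zero is Borel and bounded everywhere and changes none of the
    integrals over the type space.\<close>
  define K where "K v = indicator {0..1} v *\<^sub>R I v" for v
  have K: "K v = I v" if "v \<in> {0..1}" for v
    using that by (simp add: K_def)
  have "rent K v = rent I v" if "v \<in> {0..1}" for v
    unfolding rent_def using that by (intro set_lebesgue_integral_cong) (auto simp: K)
  then have profit: "expect_type D (\<lambda>v. rent_transfer K v - seller_cost \<tau> v_s (K v)) =
      expect_type D (\<lambda>v. rent_transfer I v - seller_cost \<tau> v_s (I v))"
    unfolding expect_type_def by (intro set_lebesgue_integral_cong) (auto simp: K rent_transfer_def)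
  have surplus: "expect_type D (virtual_surplus (cdf D) p \<tau> v_s K) =
      expect_type D (virtual_surplus (cdf D) p \<tau> v_s I)"
    unfolding expect_type_def by (intro set_lebesgue_integral_cong) (auto simp: K virtual_surplus_def)
  have "K \<in> borel_measurable borel"
    using set_borel_measurable_mono_on[OF mono] by (simp add: set_borel_measurable_def K_def[abs_def])
  moreover have "\<bar>K v\<bar> \<le> 1" for v
    using range[of v] by (auto simp: K_def indicator_def)
  moreover have "(LBINT v:{0..1}. K v) = (LBINT v:{0..1}. I v)"
    by (intro set_lebesgue_integral_cong) (auto simp: K)
  ultimately show ?thesis
    using expect_type_profit_measurable[of K \<tau> v_s] zero unfolding profit surplus by simp
qed

section \<open>Comparison of the optima\<close>

lemma seller_profit_eq:
  assumes "feasible_mechanism (I, t)"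
  shows "seller_profit D \<tau> v_s (I, t) =
    expect_type D (virtual_surplus (cdf D) p \<tau> v_s I) - (\<tau> * v_s + \<tau> * (1 - 2 * v_s) * (1 - v_s))"
proof -
  have "seller_profit D \<tau> v_s (I, t) = expect_type D (\<lambda>v. rent_transfer I v - seller_cost \<tau> v_s (I v))"
    unfolding seller_profit_def expect_type_def prod.case
    by (intro set_lebesgue_integral_cong) (auto simp: feasible_mechanism_imp(2)[OF assms])
  with expect_type_profit[OF feasible_mechanism_imp(1)[OF assms]] show ?thesis
    by simp
qed

text \<open>Among feasible mechanisms profit depends on the allocation alone, as surplus minus a
  constant. Since \<open>rent_transfer\<close> implements every feasible allocation, each competitor
  in one problem has a counterpart in the other.\<close>

lemma optimal_mechanism_iff:
  "optimal_mechanism D \<tau> v_s I t \<longleftrightarrow> feasible_mechanism (I, t) \<and> optimal_allocation D p \<tau> v_s I"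
proof -
  let ?S = "\<lambda>I. expect_type D (virtual_surplus (cdf D) p \<tau> v_s I)"
  have "(\<forall>I' t'. feasible_mechanism (I', t') \<longrightarrow>
      \<not> seller_profit D \<tau> v_s (I, t) < seller_profit D \<tau> v_s (I', t')) \<longleftrightarrow>
    (\<forall>I'. feasible_allocation I' \<longrightarrow> \<not> ?S I < ?S I')"
    if "feasible_mechanism (I, t)"
    using that by (metis diff_strict_right_mono linorder_not_less diff_right_mono
        feasible_mechanism_imp(1) feasible_mechanism_rent_transfer seller_profit_eq)
  then show ?thesis
    using feasible_mechanism_imp(1)[of I t]
    by (auto simp: optimal_mechanism_def optimal_allocation_def is_arg_max_def)
qed

end

theorem corollary4p7:
  fixes D :: "real measure" and p :: "real \<Rightarrow> real" and v_s \<tau> :: real and I :: "real \<Rightarrow> real"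
  assumes "real_distribution D"
    and "p \<in> borel_measurable borel"
    and "D = density lborel (\<lambda>v. ennreal (p v))"
    and "\<And>v. v \<in> {0..1} \<Longrightarrow> p v > 0"
    and "\<And>v. v \<notin> {0..1} \<Longrightarrow> p v = 0"
    and "v_s \<in> {0..1}"
    and "\<tau> \<ge> 0"
  shows "(\<exists>t. optimal_mechanism D \<tau> v_s I t) \<longleftrightarrow> optimal_allocation D p \<tau> v_s I"
proof -
  have "feasible_allocation I" if "optimal_allocation D p \<tau> v_s I"
    using that by (simp add: optimal_allocation_def is_arg_max_def)
  moreover have "optimal_mechanism D \<tau> v_s I t \<longleftrightarrow>
      feasible_mechanism (I, t) \<and> optimal_allocation D p \<tau> v_s I" for t
    by (rule optimal_mechanism_iff) (fact assms)+
  \<comment> \<open>From an optimal allocation, the witness for \<open>t\<close> is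
    \<open>rent_transfer I\<close>.\<close>
  ultimately show ?thesis
    using feasible_mechanism_rent_transfer by blast
qed

end
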